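(* For each $m\in\mathbb{N}$ there exists $N_m\in\mathbb{N}$ such that if $n\ge N_m$ then the graph $\mathcal{O}(\mathrm{S}_n)$, where $\mathrm{S}_n$ is the symmetric group of degree $n$, has at least $m$ connected components.
   Context: An orientably regular map $\mathcal{M}$ with orientation-preserving automorphism group $\mathrm{Aut}^+\mathcal{M}\cong G$ ($G$ a finite group) is equivalent to a generating triple $(x,y,z)$ of $G$ with $y$ of order $2$ and $xyz=1$; here $x$ rotates arcs (directed edges) around their incident vertices following the orientation, $y$ reverses arcs, and $z$ rotates arcs around faces. Two maps are isomorphic if and only if their triples are equivalent under $\mathrm{Aut}\,G$. $\mathcal{O}(G)$ denotes the set of isomorphism classes of orientably regular maps $\mathcal{M}$ with $\mathrm{Aut}^+\mathcal{M}\cong G$. The valency of (the vertices of) $\mathcal{M}$ is the order of $x$. Duality $D$ replaces $(x,y,z)$ by $(z,y,(zy)^{-1})$. For $j$ coprime to the valency, the hole operation $H_j$ replaces $(x,y,z)$ by $(x^j,y,(x^jy)^{-1})$. Both operations preserve $G$, so they act on maps in $\mathcal{O}(G)$. The set $\mathcal{O}(G)$ is regarded as the vertex set of a graph, also denoted $\mathcal{O}(G)$, in which each $\mathcal{M}$ is joined by edges to $D(\mathcal{M})$ and to $H_j(\mathcal{M})$ for all $j$ coprime to the valency of $\mathcal{M}$ (loops omitted; connectedness ignores edge directions). *)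

theory Defs
  imports "HOL-Algebra.Algebra" "Graph_Theory.Digraph_Component"
begin

section \<open>Orientably regular maps as generating triples\<close>

definition map_triples :: "('a, 'b) monoid_scheme \<Rightarrow> ('a \<times> 'a \<times> 'a) set"
  where "map_triples G = {(x, y, z). x \<in> carrier G \<and> y \<in> carrier G \<and> z \<in> carrier G \<and>
           generate G {x, y, z} = carrier G \<and>
           group.ord G y = 2 \<and> x \<otimes>\<^bsub>G\<^esub> y \<otimes>\<^bsub>G\<^esub> z = \<one>\<^bsub>G\<^esub>}"

text \<open>Two triples give isomorphic maps iff some automorphism of \<open>G\<close> carries one to the other
  coordinatewise.\<close>

definition map_isom :: "('a, 'b) monoid_scheme \<Rightarrow> ('a \<times> 'a \<times> 'a) rel"
  where "map_isom G = {(s, t). s \<in> map_triples G \<and> t \<in> map_triples G \<and>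
           (\<exists>\<phi> \<in> iso G G. t = map_prod \<phi> (map_prod \<phi> \<phi>) s)}"

definition regular_maps :: "('a, 'b) monoid_scheme \<Rightarrow> ('a \<times> 'a \<times> 'a) set set"
  where "regular_maps G = map_triples G // map_isom G"

section \<open>Duality and hole operations\<close>

fun triple_dual :: "('a, 'b) monoid_scheme \<Rightarrow> 'a \<times> 'a \<times> 'a \<Rightarrow> 'a \<times> 'a \<times> 'a"
  where "triple_dual G (x, y, z) = (z, y, inv\<^bsub>G\<^esub> (z \<otimes>\<^bsub>G\<^esub> y))"

fun triple_hole :: "('a, 'b) monoid_scheme \<Rightarrow> int \<Rightarrow> 'a \<times> 'a \<times> 'a \<Rightarrow> 'a \<times> 'a \<times> 'a"
  where "triple_hole G j (x, y, z) =
    (x [^]\<^bsub>G\<^esub> j, y, inv\<^bsub>G\<^esub> (x [^]\<^bsub>G\<^esub> j \<otimes>\<^bsub>G\<^esub> y))"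

text \<open>The operations and the valency on isomorphism classes. Their independence of the chosen
  representative is shown below (\<open>map_dual_class\<close>, \<open>map_hole_class\<close>, \<open>valency_class\<close>).\<close>

definition map_dual :: "('a, 'b) monoid_scheme \<Rightarrow> ('a \<times> 'a \<times> 'a) set \<Rightarrow> ('a \<times> 'a \<times> 'a) set"
  where "map_dual G M = (\<Union>t\<in>M. map_isom G `` {triple_dual G t})"

definition map_hole ::
    "('a, 'b) monoid_scheme \<Rightarrow> int \<Rightarrow> ('a \<times> 'a \<times> 'a) set \<Rightarrow> ('a \<times> 'a \<times> 'a) set"
  where "map_hole G j M = (\<Union>t\<in>M. map_isom G `` {triple_hole G j t})"

definition valency :: "('a, 'b) monoid_scheme \<Rightarrow> ('a \<times> 'a \<times> 'a) set \<Rightarrow> nat"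
  where "valency G M = the_elem ((\<lambda>t. group.ord G (fst t)) ` M)"

section \<open>The graph of maps\<close>

definition map_graph :: "('a, 'b) monoid_scheme \<Rightarrow> ('a \<times> 'a \<times> 'a) set pair_pre_digraph"
  where "map_graph G = \<lparr> pverts = regular_maps G,
    parcs = ({(M, map_dual G M) | M. M \<in> regular_maps G} \<union>
             {(M, map_hole G j M) | M j. M \<in> regular_maps G \<and> coprime j (int (valency G M))})
            - Id \<rparr>"

text \<open>Edge directions are ignored: components (as vertex sets) are those of the symmetric closure,
  in accordance with the definition of \<^const>\<open>connected\<close> in \<^theory>\<open>Graph_Theory.Digraph_Component\<close>.\<close>

definition graph_components :: "'v pair_pre_digraph \<Rightarrow> 'v set set"
  where "graph_components \<Gamma> = pre_digraph.sccs_verts (with_proj (mk_symmetric (with_proj \<Gamma>)))"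

section \<open>Well-definedness\<close>

context group
begin

lemma generate_eq_carrierI:
  assumes "generate G A = carrier G" "A \<subseteq> generate G B" "B \<subseteq> carrier G"
  shows "generate G B = carrier G"
proof
  show "generate G B \<subseteq> carrier G" using generate_incl assms(3) by auto
  show "carrier G \<subseteq> generate G B"
    using generate_subgroup_incl[OF assms(2) generate_is_subgroup[OF assms(3)]] assms(1) by simp
qed

lemma ord_iso:
  assumes "\<phi> \<in> iso G G" "x \<in> carrier G"
  shows "ord (\<phi> x) = ord x"
proof -
  interpret group_hom G G \<phi>
    using assms(1) by unfold_locales (auto simp: iso_def)
  have inj: "inj_on \<phi> (carrier G)" using assms(1) by (auto simp: iso_def bij_betw_def)
  have "\<phi> x [^] n = \<one> \<longleftrightarrow> x [^] n = \<one>" for n :: nat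
  proof -
    have "\<phi> (x [^] n) = \<phi> x [^] n" using assms(2) by (simp add: hom_nat_pow)
    then show ?thesis using inj assms(2) by (metis hom_one inj_onD nat_pow_closed one_closed)
  qed
  then have "ord (\<phi> x) dvd n \<longleftrightarrow> ord x dvd n" for n
    using assms(2) by (metis pow_eq_id hom_closed)
  then show ?thesis by (meson dvd_antisym dvd_refl)
qed

lemma map_isomI:
  assumes "s \<in> map_triples G" "t \<in> map_triples G" "\<phi> \<in> iso G G"
    "t = map_prod \<phi> (map_prod \<phi> \<phi>) s"
  shows "(s, t) \<in> map_isom G"
  using assms unfolding map_isom_def by blast

lemma map_isom_closed:
  assumes "(s, t) \<in> map_isom G"
  shows "s \<in> map_triples G" "t \<in> map_triples G"
  using assms unfolding map_isom_def by blast+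

lemma equiv_map_isom: "equiv (map_triples G) (map_isom G)"
proof (rule equivI)
  show "map_isom G \<subseteq> map_triples G \<times> map_triples G" by (auto simp: map_isom_def)
  show "refl_on (map_triples G) (map_isom G)"
  proof (rule refl_onI)
    fix t assume "t \<in> map_triples G"
    moreover have "(\<lambda>x. x) \<in> iso G G" by (auto simp: iso_def hom_def bij_betw_def)
    ultimately show "(t, t) \<in> map_isom G"
      unfolding map_isom_def by (force intro: bexI[of _ "\<lambda>x. x"])
  qed
  show "sym (map_isom G)"
  proof (rule symI)
    fix s t assume st: "(s, t) \<in> map_isom G"
    then obtain \<phi> where p: "\<phi> \<in> iso G G" "t = map_prod \<phi> (map_prod \<phi> \<phi>) s"
      by (auto simp: map_isom_def)
    have i: "inv_into (carrier G) \<phi> \<in> iso G G" using p(1) by (rule iso_set_sym)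
    have "inj_on \<phi> (carrier G)" using p(1) by (auto simp: iso_def bij_betw_def)
    then have "s = map_prod (inv_into (carrier G) \<phi>)
        (map_prod (inv_into (carrier G) \<phi>) (inv_into (carrier G) \<phi>)) t"
      using st p(2) by (cases s) (simp add: map_isom_def map_triples_def)
    with i st show "(t, s) \<in> map_isom G"
      using map_isomI map_isom_closed by blast
  qed
  show "trans (map_isom G)"
  proof (rule transI)
    fix s t u assume a: "(s, t) \<in> map_isom G" "(t, u) \<in> map_isom G"
    then obtain \<phi> \<psi> where p: "\<phi> \<in> iso G G" "t = map_prod \<phi> (map_prod \<phi> \<phi>) s"
      "\<psi> \<in> iso G G" "u = map_prod \<psi> (map_prod \<psi> \<psi>) t"
      by (auto simp: map_isom_def)
    have "\<psi> \<circ> \<phi> \<in> iso G G" using iso_set_trans p by blast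
    moreover have "u = map_prod (\<psi> \<circ> \<phi>) (map_prod (\<psi> \<circ> \<phi>) (\<psi> \<circ> \<phi>)) s"
      using p by (cases s) auto
    ultimately show "(s, u) \<in> map_isom G"
      using map_isomI map_isom_closed a by blast
  qed
qed

lemma triple_dual_closed:
  assumes "t \<in> map_triples G"
  shows "triple_dual G t \<in> map_triples G"
proof -
  obtain x y z where t: "t = (x, y, z)" by (cases t)
  have c: "x \<in> carrier G" "y \<in> carrier G" "z \<in> carrier G" "generate G {x, y, z} = carrier G"
    "ord y = 2" "x \<otimes> y \<otimes> z = \<one>"
    using assms by (auto simp: t map_triples_def)
  let ?B = "{z, y, inv (z \<otimes> y)}"
  have B: "?B \<subseteq> carrier G" using c by auto
  have "x \<otimes> (y \<otimes> z) = \<one>" using c m_assoc by auto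
  then have "x = inv (y \<otimes> z)" using c by (metis inv_equality inv_inv m_closed)
  then have "x \<in> generate G ?B"
    using generate_m_inv_closed[OF B] generate.eng[OF generate.incl generate.incl, of y ?B z G]
    by auto
  then have "generate G ?B = carrier G"
    using generate_eq_carrierI[OF c(4) _ B] by (auto intro: generate.incl)
  then show ?thesis using c by (auto simp: t map_triples_def)
qed

lemma triple_hole_closed:
  assumes "t \<in> map_triples G" "coprime j (int (ord (fst t)))"
  shows "triple_hole G j t \<in> map_triples G"
proof -
  obtain x y z where t: "t = (x, y, z)" by (cases t)
  have c: "x \<in> carrier G" "y \<in> carrier G" "z \<in> carrier G" "generate G {x, y, z} = carrier G"
    "ord y = 2" "x \<otimes> y \<otimes> z = \<one>" and j: "coprime j (int (ord x))"
    using assms by (auto simp: t map_triples_def)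
  let ?w = "x [^] j"
  let ?B = "{?w, y, inv (?w \<otimes> y)}"
  have B: "?B \<subseteq> carrier G" using c by auto
  interpret S: subgroup "generate G ?B" G by (rule generate_is_subgroup[OF B])
  obtain k l where kl: "k * j + l * int (ord x) = 1"
    using bezout_int[of j "int (ord x)"] j by auto
  have "1 - j * k = int (ord x) * l" using kl by (simp add: algebra_simps)
  then have "int (ord x) dvd 1 - j * k" by simp
  then have "x [^] (j * k) = x [^] (1::int)" using int_pow_eq[OF c(1)] by blast
  then have "x = ?w [^] k" using c(1) by (simp add: int_pow_pow int_pow_1)
  moreover have "?w [^] k \<in> generate G ?B"
    by (rule subgroup_int_pow_closed[OF S.subgroup_axioms generate.incl]) simp
  ultimately have x: "x \<in> generate G ?B" by simp
  have y: "y \<in> generate G ?B" by (auto intro: generate.incl)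
  have "z = inv (x \<otimes> y)" using c by (metis inv_equality inv_inv m_closed)
  then have "z \<in> generate G ?B" using x y by simp
  then have "generate G ?B = carrier G"
    using generate_eq_carrierI[OF c(4) _ B] x y by auto
  then show ?thesis using c by (auto simp: t map_triples_def)
qed

lemma map_isom_ord:
  assumes "(s, t) \<in> map_isom G"
  shows "ord (fst s) = ord (fst t)"
  using assms by (auto simp: map_isom_def map_triples_def ord_iso)

lemma map_isom_dual:
  assumes "(s, t) \<in> map_isom G"
  shows "(triple_dual G s, triple_dual G t) \<in> map_isom G"
proof -
  obtain \<phi> where p: "\<phi> \<in> iso G G" "t = map_prod \<phi> (map_prod \<phi> \<phi>) s" and
    m: "s \<in> map_triples G" "t \<in> map_triples G"
    using assms by (auto simp: map_isom_def)
  interpret group_hom G G \<phi> using p(1) by unfold_locales (auto simp: iso_def)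
  have "triple_dual G t = map_prod \<phi> (map_prod \<phi> \<phi>) (triple_dual G s)"
    using p m by (auto simp: map_triples_def)
  then show ?thesis using p(1) m triple_dual_closed map_isomI by blast
qed

lemma map_isom_hole:
  assumes "(s, t) \<in> map_isom G" "coprime j (int (ord (fst s)))"
  shows "(triple_hole G j s, triple_hole G j t) \<in> map_isom G"
proof -
  obtain \<phi> where p: "\<phi> \<in> iso G G" "t = map_prod \<phi> (map_prod \<phi> \<phi>) s" and
    m: "s \<in> map_triples G" "t \<in> map_triples G"
    using assms by (auto simp: map_isom_def)
  interpret group_hom G G \<phi> using p(1) by unfold_locales (auto simp: iso_def)
  have "triple_hole G j t = map_prod \<phi> (map_prod \<phi> \<phi>) (triple_hole G j s)"
    using p m by (auto simp: map_triples_def hom_int_pow)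
  moreover have "coprime j (int (ord (fst t)))" using assms map_isom_ord by auto
  ultimately show ?thesis using p(1) m triple_hole_closed assms(2) map_isomI by blast
qed

lemma map_dual_class:
  assumes "t \<in> map_triples G"
  shows "map_dual G (map_isom G `` {t}) = map_isom G `` {triple_dual G t}"
proof -
  have "map_isom G `` {triple_dual G s} = map_isom G `` {triple_dual G t}"
    if "s \<in> map_isom G `` {t}" for s
    using equiv_class_eq[OF equiv_map_isom map_isom_dual, of t s] that by auto
  moreover have "t \<in> map_isom G `` {t}" using equiv_class_self[OF equiv_map_isom assms] .
  ultimately show ?thesis unfolding map_dual_def by blast
qed

lemma map_hole_class:
  assumes "t \<in> map_triples G" "coprime j (int (ord (fst t)))"
  shows "map_hole G j (map_isom G `` {t}) = map_isom G `` {triple_hole G j t}"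
proof -
  have "map_isom G `` {triple_hole G j s} = map_isom G `` {triple_hole G j t}"
    if "s \<in> map_isom G `` {t}" for s
    using equiv_class_eq[OF equiv_map_isom map_isom_hole, of t s] that assms(2) by auto
  moreover have "t \<in> map_isom G `` {t}" using equiv_class_self[OF equiv_map_isom assms(1)] .
  ultimately show ?thesis unfolding map_hole_def by blast
qed

lemma valency_class:
  assumes "t \<in> map_triples G"
  shows "valency G (map_isom G `` {t}) = ord (fst t)"
proof -
  have "t \<in> map_isom G `` {t}" using equiv_class_self[OF equiv_map_isom assms] .
  then have "(\<lambda>t. ord (fst t)) ` (map_isom G `` {t}) = {ord (fst t)}"
    using map_isom_ord by fastforce
  then show ?thesis by (simp add: valency_def)
qed

lemma map_dual_closed:
  assumes "M \<in> regular_maps G"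
  shows "map_dual G M \<in> regular_maps G"
proof -
  obtain t where "t \<in> map_triples G" "M = map_isom G `` {t}"
    using assms unfolding regular_maps_def by (blast elim: quotientE)
  then show ?thesis
    unfolding regular_maps_def by (simp only: map_dual_class quotientI triple_dual_closed)
qed

lemma map_hole_closed:
  assumes "M \<in> regular_maps G" "coprime j (int (valency G M))"
  shows "map_hole G j M \<in> regular_maps G"
proof -
  obtain t where t: "t \<in> map_triples G" "M = map_isom G `` {t}"
    using assms unfolding regular_maps_def by (blast elim: quotientE)
  then have "coprime j (int (ord (fst t)))" using assms(2) by (simp only: valency_class)
  with t show ?thesis
    unfolding regular_maps_def by (simp only: map_hole_class quotientI triple_hole_closed)
qed

lemma pair_wf_digraph_map_graph: "pair_wf_digraph (map_graph G)"
  by unfold_locales (auto simp: map_graph_def map_dual_closed map_hole_closed)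

end

end

theory Submission
  imports Defs
begin

text \<open>Duality and the hole operations leave \<open>y\<close> unchanged, so every function of \<open>y\<close> that is
  invariant under automorphisms of \<open>G\<close> is constant on components. We use the set of \<open>m\<close> such that
  \<open>(y y\<^sup>g)\<^sup>m = 1\<close> for all conjugates \<open>y\<^sup>g\<close>, which avoids determining the automorphisms of \<open>S\<^sub>n\<close>
  (\<open>n = 6\<close> needs no special treatment). If \<open>y\<close> moves at most \<open>s\<close> points, then \<open>y y\<^sup>g\<close> moves at most
  \<open>2s\<close>, so \<open>(2s)!\<close> lies in this set; on the other hand a product of many transpositions has a
  conjugate with \<open>y y\<^sup>g\<close> containing a long cycle. Hence rapidly increasing numbers of
  transpositions give pairwise distinct invariants.

  Each of these \<open>y\<close> occurs in a generating triple: let \<open>x\<close> be the product of \<open>(1 2)\<close> and a cycle of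
  odd length \<open>l\<close> on the remaining points (all but \<open>n\<close> if \<open>n\<close> is even). Then \<open>x\<^sup>l = (1 2)\<close>, and
  conjugating by \<open>y\<close>, which fixes \<open>1\<close>, and by even powers of \<open>x\<close> yields all transpositions
  \<open>(1 v)\<close>.\<close>

section \<open>Invariants of components\<close>

context group
begin

text \<open>Both operations keep the middle coordinate literally. Passing between representatives of
  a class changes it by an automorphism, which \<open>f\<close> does not see.\<close>

lemma map_graph_arc_invariant:
  assumes f: "\<And>\<phi> y. \<phi> \<in> iso G G \<Longrightarrow> y \<in> carrier G \<Longrightarrow> f (\<phi> y) = f y"
    and arc: "(M, N) \<in> parcs (map_graph G)" and s: "s \<in> M" and t: "t \<in> N"
  shows "f (fst (snd s)) = f (fst (snd t))"
proof -
  have isom: "f (fst (snd p)) = f (fst (snd q))" if "(p, q) \<in> map_isom G" for p q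
    using that f by (auto simp: map_isom_def map_triples_def)
  obtain s0 where s0: "s0 \<in> map_triples G" "M = map_isom G `` {s0}"
    using arc by (force simp: map_graph_def regular_maps_def elim: quotientE)
  have st: "s \<in> map_triples G" using s s0 map_isom_closed by auto
  have Ms: "M = map_isom G `` {s}"
    using s s0 equiv_class_eq[OF equiv_map_isom, of s0 s] by auto
  consider "N = map_dual G M"
    | j where "N = map_hole G j M" "coprime j (int (valency G M))"
    using arc by (auto simp: map_graph_def)
  then show ?thesis
  proof cases
    case 1
    then have "(triple_dual G s, t) \<in> map_isom G"
      using t Ms map_dual_class[OF st] by auto
    from isom[OF this] show ?thesis by (cases s) simp
  next
    case 2
    then have "coprime j (int (ord (fst s)))" using valency_class[OF st] Ms by simp
    then have "(triple_hole G j s, t) \<in> map_isom G"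
      using t Ms 2 map_hole_class[OF st] by auto
    from isom[OF this] show ?thesis by (cases s) simp
  qed
qed

lemma reachable_invariant:
  assumes f: "\<And>\<phi> y. \<phi> \<in> iso G G \<Longrightarrow> y \<in> carrier G \<Longrightarrow> f (\<phi> y) = f y"
    and reach: "M \<rightarrow>\<^sup>*\<^bsub>with_proj (mk_symmetric (with_proj (map_graph G)))\<^esub> N"
    and s: "s \<in> M" and t: "t \<in> N"
  shows "f (fst (snd s)) = f (fst (snd t))"
proof -
  interpret W: pair_wf_digraph "map_graph G" by (rule pair_wf_digraph_map_graph)
  interpret S: pair_wf_digraph "mk_symmetric (with_proj (map_graph G))" by rule
  have arc: "f (fst (snd p)) = f (fst (snd q))"
    if "(A, B) \<in> parcs (mk_symmetric (with_proj (map_graph G)))" "p \<in> A" "q \<in> B" for A B p q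
    using that map_graph_arc_invariant[of f A B p q] map_graph_arc_invariant[of f B A q p] f
    by (auto simp: parcs_mk_symmetric)
  have regular: "A \<in> regular_maps G"
    if "M \<rightarrow>\<^sup>*\<^bsub>with_proj (mk_symmetric (with_proj (map_graph G)))\<^esub> A" for A
    using S.reachable_in_verts(2)[OF that] by (simp add: map_graph_def)
  have nonempty: "A \<noteq> {}" if "A \<in> regular_maps G" for A
    using that in_quotient_imp_non_empty[OF equiv_map_isom] unfolding regular_maps_def by blast
  have isom: "f (fst (snd p)) = f (fst (snd q))" if "(p, q) \<in> map_isom G" for p q
    using that f by (auto simp: map_isom_def map_triples_def)
  \<comment> \<open>Quantifying over all representatives lets the inductive step pass through an
    arbitrary element of the intermediate class.\<close>
  from reach have "\<forall>t\<in>N. f (fst (snd s)) = f (fst (snd t))"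
  proof (induction rule: S.reachable_induct)
    case base
    then have "M \<in> map_triples G // map_isom G" by (simp add: map_graph_def regular_maps_def)
    then show ?case
      using s isom in_quotient_imp_in_rel[OF equiv_map_isom] by blast
  next
    case (step A B)
    obtain p where "p \<in> A" using nonempty[OF regular[OF step(1)]] by blast
    moreover have "(A, B) \<in> parcs (mk_symmetric (with_proj (map_graph G)))"
      using step(2) by simp
    ultimately show ?case using step(3) arc by metis
  qed
  then show ?thesis using t by blast
qed

lemma card_graph_components_ge:
  fixes f :: "'a \<Rightarrow> 'c"
  assumes fin: "finite (carrier G)"
    and f: "\<And>\<phi> y. \<phi> \<in> iso G G \<Longrightarrow> y \<in> carrier G \<Longrightarrow> f (\<phi> y) = f y"
  shows "card ((\<lambda>t. f (fst (snd t))) ` map_triples G) \<le> card (graph_components (map_graph G))"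
proof -
  let ?S = "with_proj (mk_symmetric (with_proj (map_graph G)))"
  interpret W: pair_wf_digraph "map_graph G" by (rule pair_wf_digraph_map_graph)
  interpret S: pair_wf_digraph "mk_symmetric (with_proj (map_graph G))" by rule
  have comps: "graph_components (map_graph G) = pre_digraph.scc_of ?S ` regular_maps G"
    unfolding graph_components_def S.sccs_verts_conv_scc_of by (simp add: map_graph_def)
  have "map_triples G \<subseteq> carrier G \<times> carrier G \<times> carrier G"
    by (auto simp: map_triples_def)
  then have "finite (map_triples G)" using fin finite_subset by blast
  then have "finite (regular_maps G)"
    unfolding regular_maps_def
    by (rule finite_quotient) (auto simp: map_isom_def)
  \<comment> \<open>An infinite set would have \<open>card\<close> equal to 0, so the bound depends
    on this finiteness.\<close>
  then have fin_comps: "finite (graph_components (map_graph G))" by (simp add: comps)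
  \<comment> \<open>By \<open>reachable_invariant\<close> all candidate values in a component agree,
    so the choice is forced and \<open>h\<close> attains every value of \<open>f\<close> on
    triples.\<close>
  define h where "h C = (SOME v. \<exists>M\<in>C. \<exists>t\<in>M. v = f (fst (snd t)))"
    for C :: "('a \<times> 'a \<times> 'a) set set"
  have "(\<lambda>t. f (fst (snd t))) ` map_triples G \<subseteq> h ` graph_components (map_graph G)"
  proof (rule image_subsetI)
    fix t assume t: "t \<in> map_triples G"
    let ?M = "map_isom G `` {t}"
    let ?C = "pre_digraph.scc_of ?S ?M"
    have M: "?M \<in> regular_maps G" using t unfolding regular_maps_def by (rule quotientI)
    have tM: "t \<in> ?M" using equiv_class_self[OF equiv_map_isom t] .
    have MC: "?M \<in> ?C" using M by (intro S.in_scc_of_self) (simp add: map_graph_def)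
    have "\<exists>M\<in>?C. \<exists>s\<in>M. h ?C = f (fst (snd s))"
      unfolding h_def by (rule someI_ex) (use MC tM in blast)
    then obtain N s where N: "N \<in> ?C" "s \<in> N" "h ?C = f (fst (snd s))" by blast
    have "?M \<rightarrow>\<^sup>*\<^bsub>?S\<^esub> N" using N(1) by (simp add: S.scc_of_def)
    then have "f (fst (snd t)) = f (fst (snd s))"
      by (rule reachable_invariant[of f, OF _ _ tM N(2), rotated]) (rule f)
    then have "f (fst (snd t)) = h ?C" using N(3) by simp
    then show "f (fst (snd t)) \<in> h ` graph_components (map_graph G)"
      using M comps by blast
  qed
  then show ?thesis using fin_comps by (rule surj_card_le[rotated])
qed

end

text \<open>For a finite group and \<open>y\<close> in its carrier, these are the multiples of the
  least common multiple of the orders of all products of \<open>y\<close> with a conjugate of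
  \<open>y\<close>.\<close>

definition conj_exponents :: "('a, 'b) monoid_scheme \<Rightarrow> 'a \<Rightarrow> nat set"
  where "conj_exponents G y =
    {m. \<forall>g\<in>carrier G. (y \<otimes>\<^bsub>G\<^esub> (g \<otimes>\<^bsub>G\<^esub> y \<otimes>\<^bsub>G\<^esub> inv\<^bsub>G\<^esub> g)) [^]\<^bsub>G\<^esub> m = \<one>\<^bsub>G\<^esub>}"

lemma (in group) conj_exponents_iso:
  assumes "\<phi> \<in> iso G G" "y \<in> carrier G"
  shows "conj_exponents G (\<phi> y) = conj_exponents G y"
proof -
  interpret group_hom G G \<phi> using assms(1) by unfold_locales (auto simp: iso_def)
  have inj: "inj_on \<phi> (carrier G)" and surj: "\<phi> ` carrier G = carrier G"
    using assms(1) by (auto simp: iso_def bij_betw_def)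
  have "(\<phi> y \<otimes> (\<phi> g \<otimes> \<phi> y \<otimes> inv \<phi> g)) [^] m = \<one> \<longleftrightarrow> (y \<otimes> (g \<otimes> y \<otimes> inv g)) [^] m = \<one>"
    if g: "g \<in> carrier G" for g and m :: nat
  proof -
    have "(\<phi> y \<otimes> (\<phi> g \<otimes> \<phi> y \<otimes> inv \<phi> g)) [^] m = \<phi> ((y \<otimes> (g \<otimes> y \<otimes> inv g)) [^] m)"
      using g assms(2) by (simp add: hom_nat_pow)
    then show ?thesis
      using inj_on_eq_iff[OF inj, of "(y \<otimes> (g \<otimes> y \<otimes> inv g)) [^] m" \<one>] g assms(2) by simp
  qed
  \<comment> \<open>Surjectivity lets the conjugators for \<open>\<phi> y\<close> be written as
    \<open>\<phi> g\<close>.\<close>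
  then show ?thesis
    unfolding conj_exponents_def by (subst surj[symmetric]) auto
qed

section \<open>Permutations\<close>

lemma involution_permutes:
  assumes "\<And>v. f (f v) = v" "\<And>v. v \<notin> S \<Longrightarrow> f v = v"
  shows "f permutes S"
  unfolding permutes_def using assms by metis

text \<open>The orbit of a moved point stays in \<open>D\<close>. By pigeonhole it returns after at
  most \<open>s\<close> steps, and this return time divides \<open>fact s\<close>.\<close>

lemma funpow_fact_eq_id:
  assumes inj: "inj p" and fin: "finite D" and D: "\<And>v. p v \<noteq> v \<Longrightarrow> v \<in> D" and card: "card D \<le> s"
  shows "p ^^ fact s = id"
proof
  fix v
  have injp: "inj (p ^^ i)" for i using inj by (rule inj_fn)
  show "(p ^^ fact s) v = id v"
  proof (cases "p v = v")
    case True
    have "(p ^^ i) v = v" for i by (induction i) (simp_all add: True)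
    then show ?thesis by simp
  next
    case False
    have "(p ^^ i) v \<in> D" for i
    proof (rule D)
      have "p ((p ^^ i) v) = (p ^^ i) (p v)" by (simp add: funpow_swap1)
      then show "p ((p ^^ i) v) \<noteq> (p ^^ i) v" using False injD[OF injp] by metis
    qed
    then have "(\<lambda>i. (p ^^ i) v) ` {..s} \<subseteq> D" by blast
    then have "card ((\<lambda>i. (p ^^ i) v) ` {..s}) \<le> card D" using fin by (intro card_mono)
    then have "card ((\<lambda>i. (p ^^ i) v) ` {..s}) < card {..s}" using card by simp
    then have "\<not> inj_on (\<lambda>i. (p ^^ i) v) {..s}" by (rule pigeonhole)
    then obtain i j where ij: "i < j" "j \<le> s" "(p ^^ i) v = (p ^^ j) v"
      unfolding inj_on_def by (metis atMost_iff nat_neq_iff)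
    have "(p ^^ i) ((p ^^ (j - i)) v) = (p ^^ i) v"
      using ij by (simp flip: funpow_add[THEN fun_cong, unfolded o_apply])
    then have fixed: "(p ^^ (j - i)) v = v" using injD[OF injp] by blast
    have "j - i dvd fact s" using ij by (intro dvd_fact) auto
    then obtain q where q: "fact s = (j - i) * q" ..
    have "((p ^^ (j - i)) ^^ q) v = v" by (induction q) (simp_all add: fixed)
    then show ?thesis by (simp add: q funpow_mult)
  qed
qed

lemma sym_group_pow: "p [^]\<^bsub>sym_group n\<^esub> (m::nat) = p ^^ m"
  by (induction m) (simp_all add: sym_group_one sym_group_mult nat_pow_def funpow_swap1 fun_eq_iff)

lemma transpose_conj:
  assumes "bij g"
  shows "g \<circ> Transposition.transpose a b \<circ> inv' g = Transposition.transpose (g a) (g b)"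
proof -
  have "Transposition.transpose (g a) (g b) \<circ> g = g \<circ> Transposition.transpose a b"
    using assms by (simp add: transpose_comp_eq bij_is_inj)
  then show ?thesis using assms by (metis bij_is_surj comp_assoc comp_id surj_iff)
qed

lemma (in group) subgroup_nat_pow_closed:
  assumes "subgroup H G" "h \<in> H"
  shows "h [^] (m::nat) \<in> H"
  using assms by (induction m) (auto simp: subgroup.one_closed subgroup.m_closed)

text \<open>All transpositions are available, since (a b) = (1 a)(1 b)(1 a).\<close>

lemma sym_group_subgroup_star:
  assumes H: "subgroup H (sym_group n)"
    and star: "\<And>v. v \<in> {1..n} \<Longrightarrow> Transposition.transpose 1 v \<in> H"
  shows "H = carrier (sym_group n)"
proof
  show "H \<subseteq> carrier (sym_group n)" using H by (rule subgroup.subset)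
  have comp: "p \<circ> q \<in> H" if "p \<in> H" "q \<in> H" for p q
    using subgroup.m_closed[OF H that] by (simp add: sym_group_mult)
  show "carrier (sym_group n) \<subseteq> H"
  proof
    fix p assume "p \<in> carrier (sym_group n)"
    then have "p permutes {1..n}" by (simp add: sym_group_carrier)
    then show "p \<in> H" using finite_atLeastAtMost
    proof (induction p rule: permutes_induct)
      case id
      show ?case using subgroup.one_closed[OF H] by (simp only: sym_group_one)
    next
      case (swap a b p)
      have "Transposition.transpose a b \<in> H"
      proof (cases "a = 1 \<or> b = 1")
        case True
        then show ?thesis using star swap by (metis transpose_commute)
      next
        case False
        then have "Transposition.transpose 1 a \<circ> Transposition.transpose 1 b \<circ>
            Transposition.transpose 1 a = Transposition.transpose a b"
          using swap by (auto simp: fun_eq_iff Transposition.transpose_def)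
        then show ?thesis using star swap comp by metis
      qed
      then show ?case using comp swap by blast
    qed
  qed
qed

section \<open>The generating triples\<close>

text \<open>The cycle is (3 4 ... l+2): writing v = 3 + r, the formula becomes 3 + (r + 1) mod
  l.\<close>

definition vertex_rot :: "nat \<Rightarrow> nat \<Rightarrow> nat"
  where "vertex_rot l v = (if v = 1 then 2 else if v = 2 then 1
    else if v \<in> {3..l + 2} then 3 + (v - 2) mod l else v)"

text \<open>The product of the transpositions \<open>(2 3)\<close>, \<open>(4 n)\<close>, \<open>(5 6)\<close>, ..., \<open>(2k+3 2k+4)\<close>.\<close>

definition arc_rev :: "nat \<Rightarrow> nat \<Rightarrow> nat \<Rightarrow> nat"
  where "arc_rev n k v = (if v = 2 then 3 else if v = 3 then 2
    else if v = 4 then n else if v = n then 4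
    else if v \<in> {5..2 * k + 4} then if odd v then v + 1 else v - 1 else v)"

lemma vertex_rot_funpow_cycle:
  assumes "r < l"
  shows "(vertex_rot l ^^ e) (3 + r) = 3 + (r + e) mod l"
proof (induction e)
  case 0
  then show ?case using assms by simp
next
  case (Suc e)
  have "(r + e) mod l < l" using assms by simp
  then have "vertex_rot l (3 + (r + e) mod l) = 3 + ((r + e) mod l + 1) mod l"
    by (simp add: vertex_rot_def)
  also have "\<dots> = 3 + (r + Suc e) mod l" by (simp add: mod_simps)
  finally show ?case using Suc by simp
qed

lemma vertex_rot_funpow_swap:
  "(vertex_rot l ^^ e) 1 = (if even e then 1 else 2)"
  "(vertex_rot l ^^ e) 2 = (if even e then 2 else 1)"
  by (induction e) (auto simp: vertex_rot_def)

lemma vertex_rot_funpow_fixed: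
  "v \<notin> {1..l + 2} \<Longrightarrow> (vertex_rot l ^^ e) v = v"
  by (induction e) (auto simp: vertex_rot_def)

lemma vertex_rot_cases:
  fixes v l :: nat
  obtains "v = 1" | "v = 2" | r where "r < l" "v = 3 + r" | "v \<notin> {1..l + 2}"
proof -
  have "v = 1 \<or> v = 2 \<or> (v - 3 < l \<and> v = 3 + (v - 3)) \<or> v \<notin> {1..l + 2}" by auto
  then show ?thesis using that by blast
qed

lemma vertex_rot_funpow_transpose:
  assumes "odd l"
  shows "vertex_rot l ^^ l = Transposition.transpose 1 2"
proof
  fix v
  show "(vertex_rot l ^^ l) v = Transposition.transpose 1 2 v"
    using assms by (cases rule: vertex_rot_cases[where v = v and l = l])
      (auto simp: vertex_rot_funpow_cycle vertex_rot_funpow_swap[unfolded One_nat_def]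
        vertex_rot_funpow_fixed Transposition.transpose_def)
qed

lemma vertex_rot_permutes:
  assumes "odd l" "l + 2 \<le> n"
  shows "vertex_rot l permutes {1..n}"
proof -
  have pos: "l > 0" using assms by (auto intro: Nat.gr0I)
  \<comment> \<open>Bijectivity comes from this relation: the power with exponent 2l - 1 is a
    two-sided inverse.\<close>
  have "vertex_rot l ^^ (l + l) = id"
    by (simp add: funpow_add vertex_rot_funpow_transpose[OF assms(1)])
  moreover have "l + l = Suc (l + l - 1)" using pos by simp
  ultimately have "vertex_rot l \<circ> (vertex_rot l ^^ (l + l - 1)) = id"
    "(vertex_rot l ^^ (l + l - 1)) \<circ> vertex_rot l = id"
    by (metis funpow.simps(2), metis funpow_Suc_right)
  then have "bij (vertex_rot l)" by (metis o_bij)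
  moreover have "vertex_rot l v = v" if "v \<notin> {1..n}" for v
    using that assms by (auto simp: vertex_rot_def)
  ultimately show ?thesis by (simp add: permutes_def bij_iff)
qed

lemma arc_rev_involution:
  assumes "2 * k + 4 < n"
  shows "arc_rev n k (arc_rev n k v) = v"
proof -
  consider "v = 2" | "v = 3" | "v = 4" | "v = n" | "v \<notin> {2, 3, 4, n}" "v \<notin> {5..2 * k + 4}"
    | "odd v" "v \<in> {5..2 * k + 4}" | "even v" "v \<in> {5..2 * k + 4}"
    by blast
  then show ?thesis
  proof cases
    case 5
    then have "arc_rev n k v = v" unfolding arc_rev_def by auto
    then show ?thesis by simp
  next
    case 6
    \<comment> \<open>The upper end \<open>2 * k + 4\<close> is even, so an odd \<open>v\<close> in
      the range lies strictly below it.\<close>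
    then have "v + 1 \<in> {5..2 * k + 4}" by simp presburger
    moreover have "arc_rev n k v = v + 1" using 6 assms by (simp add: arc_rev_def)
    ultimately show ?thesis using 6 assms by (simp add: arc_rev_def)
  next
    case 7
    then have "v - 1 \<in> {5..2 * k + 4}" by simp presburger
    moreover have "arc_rev n k v = v - 1" using 7 assms by (simp add: arc_rev_def)
    ultimately show ?thesis using 7 assms by (simp add: arc_rev_def)
  qed (use assms in \<open>simp_all add: arc_rev_def\<close>)
qed

lemma arc_rev_permutes:
  assumes "2 * k + 4 < n"
  shows "arc_rev n k permutes {1..n}"
proof (rule involution_permutes)
  show "arc_rev n k v = v" if "v \<notin> {1..n}" for v using that assms by (auto simp: arc_rev_def)
qed (rule arc_rev_involution[OF assms])

text \<open>The bound \<open>3 \<le> l\<close> puts 4 on the cycle, and \<open>n \<le> l + 3\<close>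
  leaves at most the point \<open>n\<close> outside {1..l+2}.\<close>

lemma generate_vertex_rot_arc_rev:
  assumes k: "2 * k + 4 < n" and l: "odd l" "3 \<le> l" "l + 2 \<le> n" "n \<le> l + 3"
    and H: "subgroup H (sym_group n)" "vertex_rot l \<in> H" "arc_rev n k \<in> H"
  shows "H = carrier (sym_group n)"
proof (rule sym_group_subgroup_star[OF H(1)])
  let ?t = "Transposition.transpose :: nat \<Rightarrow> nat \<Rightarrow> _"
  have pow: "vertex_rot l ^^ e \<in> H" for e
    using group.subgroup_nat_pow_closed[OF sym_group_is_group H(1,2)] by (simp add: sym_group_pow)
  have conj: "?t (g a) (g b) \<in> H" if "g \<in> H" "?t a b \<in> H" for g a b
  proof -
    have g: "g \<in> carrier (sym_group n)" using that(1) subgroup.subset[OF H(1)] by blast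
    then have "bij g" by (simp add: sym_group_carrier permutes_bij)
    moreover have "g \<circ> ?t a b \<circ> inv' g \<in> H"
      using that g subgroup.m_closed[OF H(1)] subgroup.m_inv_closed[OF H(1) that(1)]
      by (metis sym_group_inv_equality sym_group_mult)
    ultimately show ?thesis by (simp add: transpose_conj)
  qed
  have rev: "arc_rev n k 1 = 1" "arc_rev n k 2 = 3" "arc_rev n k 4 = n"
    using k by (auto simp: arc_rev_def)
  have t2: "?t 1 2 \<in> H" using pow[of l] l by (simp add: vertex_rot_funpow_transpose)
  then have t3: "?t 1 3 \<in> H" using conj[OF H(3) t2] rev by simp
  have tc: "?t 1 (3 + r) \<in> H" if r: "r < l" for r
  proof -
    \<comment> \<open>As \<open>l\<close> is odd, every residue mod \<open>l\<close> has an even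
      representative; even powers of the rotation fix 1 and can carry 3 to 3 + r.\<close>
    define e where "e = (if even r then r else r + l)"
    have "even e" "e mod l = r" using l(1) r by (auto simp: e_def)
    then show ?thesis
      using conj[OF pow[of e] t3] vertex_rot_funpow_cycle[of 0 l e] r
      by (simp add: vertex_rot_funpow_swap[unfolded One_nat_def])
  qed
  \<comment> \<open>This is the purpose of the factor (4 n): if n = l + 3, the rotation fixes
    \<open>n\<close>, and only \<open>arc_rev\<close> links it to the cycle.\<close>
  have tn: "?t 1 n \<in> H" using conj[OF H(3) tc[of 1]] rev l by simp
  fix v assume "v \<in> {1..n}"
  then consider "v = 1" | "v = 2" | "v - 3 < l" "v = 3 + (v - 3)" | "v = n"
    using l by fastforce
  then show "?t 1 v \<in> H"
  proof cases
    case 1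
    then show ?thesis using pow[of 0] by simp
  qed (use t2 tc[of "v - 3"] tn in auto)
qed

lemma arc_rev_triple:
  assumes k: "2 * k + 4 < n" "7 \<le> n"
  obtains x z where "(x, arc_rev n k, z) \<in> map_triples (sym_group n)"
proof -
  let ?G = "sym_group n"
  interpret G: group ?G by (rule sym_group_is_group)
  \<comment> \<open>The largest odd length with \<open>l + 2 \<le> n\<close>.\<close>
  define l where "l = (if odd n then n - 2 else n - 3)"
  have l: "odd l" "3 \<le> l" "l + 2 \<le> n" "n \<le> l + 3" using k(2) by (auto simp: l_def)
  let ?x = "vertex_rot l" and ?y = "arc_rev n k"
  let ?z = "inv\<^bsub>?G\<^esub> (?x \<otimes>\<^bsub>?G\<^esub> ?y)"
  have x: "?x \<in> carrier ?G" using vertex_rot_permutes[OF l(1,3)] by (simp add: sym_group_carrier)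
  have y: "?y \<in> carrier ?G" using arc_rev_permutes[OF k(1)] by (simp add: sym_group_carrier)
  have z: "?z \<in> carrier ?G" using x y by (intro G.inv_closed G.m_closed)
  have sub: "{?x, ?y, ?z} \<subseteq> carrier ?G" using x y z by blast
  have "generate ?G {?x, ?y, ?z} = carrier ?G"
    by (rule generate_vertex_rot_arc_rev[OF k(1) l G.generate_is_subgroup[OF sub]])
      (auto intro: generate.incl)
  moreover have "G.ord ?y = 2"
  proof -
    have "?y [^]\<^bsub>?G\<^esub> (2::nat) = \<one>\<^bsub>?G\<^esub>"
      using arc_rev_involution[OF k(1)]
      unfolding sym_group_pow sym_group_one by (simp add: fun_eq_iff numeral_2_eq_2)
    then have "G.ord ?y dvd 2" using G.pow_eq_id[OF y] by simp
    moreover have "?y \<noteq> \<one>\<^bsub>?G\<^esub>"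
      by (auto simp: sym_group_one fun_eq_iff arc_rev_def intro!: exI[of _ 2])
    then have "G.ord ?y \<noteq> 1" using G.ord_eq_1[OF y] by simp
    ultimately show ?thesis using prime_nat_iff two_is_prime_nat by blast
  qed
  ultimately have "(?x, ?y, ?z) \<in> map_triples ?G"
    using x y z G.r_inv[OF G.m_closed[OF x y]] by (simp only: map_triples_def) blast
  then show ?thesis by (rule that)
qed

section \<open>Separating the components\<close>

text \<open>The involution has k + 2 transpositions and moves 2k + 4 points, so its product with a
  conjugate moves at most twice as many.\<close>

lemma fact_in_conj_exponents:
  assumes k: "2 * k + 4 < n"
  shows "fact (4 * k + 8) \<in> conj_exponents (sym_group n) (arc_rev n k)"
proof -
  let ?y = "arc_rev n k"
  have "(?y \<circ> (g \<circ> ?y \<circ> inv' g)) ^^ fact (4 * k + 8) = id" if g: "g permutes {1..n}" for g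
  proof (rule funpow_fact_eq_id)
    let ?D = "insert n {2..2 * k + 4}"
    have D: "v \<in> ?D" if "?y v \<noteq> v" for v
      using that by (auto simp: arc_rev_def split: if_splits)
    show "inj (?y \<circ> (g \<circ> ?y \<circ> inv' g))"
      using g arc_rev_permutes[OF k] permutes_inv[OF g] by (simp add: inj_compose permutes_inj)
    show "finite (?D \<union> g ` ?D)" by simp
    show "v \<in> ?D \<union> g ` ?D" if "(?y \<circ> (g \<circ> ?y \<circ> inv' g)) v \<noteq> v" for v
    proof (rule ccontr)
      assume v: "v \<notin> ?D \<union> g ` ?D"
      have "g (inv' g v) = v" using g by (rule permutes_inverses)
      then have "inv' g v \<notin> ?D" using v by (metis UnI2 imageI)
      then have "?y (inv' g v) = inv' g v" using D by blast
      then have "(?y \<circ> (g \<circ> ?y \<circ> inv' g)) v = ?y v" using \<open>g (inv' g v) = v\<close> by simp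
      then show False using that v D by auto
    qed
    have "card ?D \<le> 2 * k + 4" using card_insert_le_m1[of "2 * k + 4" "{2..2 * k + 4}" n] by simp
    moreover have "card (g ` ?D) \<le> card ?D" by (rule card_image_le) simp
    moreover have "card (?D \<union> g ` ?D) \<le> card ?D + card (g ` ?D)" by (rule card_Un_le)
    ultimately show "card (?D \<union> g ` ?D) \<le> 4 * k + 8" by linarith
  qed
  then show ?thesis
    by (simp add: conj_exponents_def sym_group_carrier sym_group_mult sym_group_one sym_group_pow)
qed

text \<open>Conjugating by a reflection pairs \<open>6\<close> with \<open>7\<close>, \<open>8\<close> with \<open>9\<close>, etc., so that the product
  with the original involution runs through \<open>6\<close>, \<open>8\<close>, \<open>10\<close>, and so on.\<close>

lemma notin_conj_exponents:
  assumes k: "2 * k + 4 < n" and m: "0 < m" "m < k"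
  shows "m \<notin> conj_exponents (sym_group n) (arc_rev n k)"
proof -
  let ?y = "arc_rev n k"
  \<comment> \<open>The reflection swaps 6 with 2k + 4 and preserves parity. It carries the pair
    {2k+3, 2k+4} to {7, 6}, and so on downwards.\<close>
  define g where "g v = (if v \<in> {6..2 * k + 4} then 2 * k + 10 - v else v)" for v
  have gg: "g (g v) = v" for v by (auto simp: g_def)
  have g: "g permutes {1..n}"
    by (rule involution_permutes[OF gg]) (use k in \<open>auto simp: g_def\<close>)
  have inv_g: "inv' g = g" using gg by (intro inv_equality) auto
  define p where "p = ?y \<circ> (g \<circ> ?y \<circ> g)"
  have step: "p v = v + 2" if v: "even v" "6 \<le> v" "v \<le> 2 * k + 2" for v
  proof -
    have "g v = 2 * k + 10 - v" using v by (simp add: g_def)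
    moreover have "?y (2 * k + 10 - v) = 2 * k + 9 - v" using v k by (auto simp: arc_rev_def)
    moreover have "2 * k + 9 - v \<in> {6..2 * k + 4}" using v by (auto elim!: evenE)
    then have "g (2 * k + 9 - v) = v + 1" using v by (simp add: g_def)
    moreover have "?y (v + 1) = v + 2" using v k by (auto simp: arc_rev_def)
    ultimately show ?thesis by (simp add: p_def)
  qed
  \<comment> \<open>The last admissible start of a step is 2k + 2, so k - 1 steps lead from 6 to 2k
    + 4 without a return; hence \<open>m < k\<close> below.\<close>
  have "(p ^^ i) 6 = 6 + 2 * i" if "i < k" for i
    using that by (induction i) (auto simp: step)
  then have "(p ^^ m) 6 \<noteq> id 6" using m by simp
  then have "p ^^ m \<noteq> id" by metis
  moreover have "g \<in> carrier (sym_group n)" using g by (simp add: sym_group_carrier)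
  ultimately show ?thesis
    by (auto simp: conj_exponents_def sym_group_mult sym_group_one sym_group_pow
        p_def inv_g intro!: bexI[of _ g])
qed

text \<open>Each value strictly exceeds the exponent that \<open>fact_in_conj_exponents\<close>
  gives for its predecessor, as \<open>notin_conj_exponents\<close> requires.\<close>

primrec pair_count :: "nat \<Rightarrow> nat"
  where "pair_count 0 = 0"
  | "pair_count (Suc i) = fact (4 * pair_count i + 8) + 1"

lemma pair_count_mono:
  assumes "i \<le> j"
  shows "pair_count i \<le> pair_count j"
proof (rule lift_Suc_mono_le[OF _ assms])
  show "pair_count i \<le> pair_count (Suc i)" for i
    using fact_ge_self[of "4 * pair_count i + 8"] by simp
qed

theorem corollary11p2:
  fixes m :: nat
  shows "\<exists>N::nat. \<forall>n\<ge>N. m \<le> card (graph_components (map_graph (sym_group n)))"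
proof (intro exI allI impI)
  \<comment> \<open>This fixes the witness for \<open>N\<close>: it yields \<open>7 \<le> n\<close>
    and room for all \<open>pair_count i\<close> with \<open>i < m\<close>, by monotonicity.\<close>
  fix n assume n: "2 * pair_count m + 7 \<le> n"
  let ?G = "sym_group n"
  interpret G: group ?G by (rule sym_group_is_group)
  let ?y = "\<lambda>i. arc_rev n (pair_count i)"
  let ?f = "\<lambda>i. conj_exponents ?G (?y i)"
  have k: "2 * pair_count i + 4 < n" if "i < m" for i
    using pair_count_mono[of i m] that n by simp
  have neq: "?f i \<noteq> ?f j" if ij: "i < j" "j < m" for i j
  proof -
    \<comment> \<open>This single exponent separates the two sets: it is valid for index
      \<open>i\<close> but too small for every later index.\<close>
    have "fact (4 * pair_count i + 8) \<in> ?f i" using k ij by (intro fact_in_conj_exponents) auto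
    moreover have "fact (4 * pair_count i + 8) < pair_count j"
      using pair_count_mono[of "Suc i" j] ij by simp
    then have "fact (4 * pair_count i + 8) \<notin> ?f j"
      using k ij by (intro notin_conj_exponents) auto
    ultimately show ?thesis by metis
  qed
  have "inj_on ?f {..<m}"
    by (rule linorder_inj_onI) (use neq in auto)
  then have "m = card (?f ` {..<m})" by (simp add: card_image)
  also have "\<dots> \<le> card ((\<lambda>t. conj_exponents ?G (fst (snd t))) ` map_triples ?G)"
  proof (rule card_mono)
    have "finite (carrier ?G)" by (simp add: sym_group_def finite_permutations)
    moreover have "map_triples ?G \<subseteq> carrier ?G \<times> carrier ?G \<times> carrier ?G"
      by (auto simp: map_triples_def)
    ultimately have "finite (map_triples ?G)" using finite_subset by blast
    then show "finite ((\<lambda>t. conj_exponents ?G (fst (snd t))) ` map_triples ?G)" by simp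
    show "?f ` {..<m} \<subseteq> (\<lambda>t. conj_exponents ?G (fst (snd t))) ` map_triples ?G"
    proof (rule image_subsetI)
      fix i assume "i \<in> {..<m}"
      then have "2 * pair_count i + 4 < n" using k by simp
      moreover have "7 \<le> n" using n by simp
      ultimately obtain x z where "(x, ?y i, z) \<in> map_triples ?G" by (rule arc_rev_triple)
      then show "?f i \<in> (\<lambda>t. conj_exponents ?G (fst (snd t))) ` map_triples ?G" by force
    qed
  qed
  also have "\<dots> \<le> card (graph_components (map_graph ?G))"
    using G.conj_exponents_iso
    by (intro G.card_graph_components_ge) (auto simp: sym_group_def finite_permutations)
  finally show "m \<le> card (graph_components (map_graph ?G))" .
qed

end
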